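(* Let $\mathcal{L}:[0,1]\to[0,1]$ be the Lüroth map and let $x$ be any number in $[0,1]$. (i) If $\liminf_{n\to\infty}\mathcal{L}^n(x)>0$, then $\operatorname{AS}_{\mathcal{L}}(x)$ is a countable set. (ii) If $\lim_{n\to\infty}\mathcal{L}^n(x)=0$, then $\dim_{\mathrm H}(\operatorname{AS}_{\mathcal{L}}(x))=\frac12$. (iii) If $\liminf_{n\to\infty}\mathcal{L}^n(x)=0$ and $\limsup_{n\to\infty}\mathcal{L}^n(x)>0$, then $\dim_{\mathrm H}(\operatorname{AS}_{\mathcal{L}}(x))\le\frac12$.
   Context: For $x\in(0,1]$, $a_1(x)$ is the unique integer $\ge 2$ with $\frac{1}{a_1(x)}<x\le\frac{1}{a_1(x)-1}$. The Lüroth map $\mathcal{L}:[0,1]\to[0,1]$ is $\mathcal{L}(x)=a_1(x)(a_1(x)-1)x-(a_1(x)-1)$ for $x\in(0,1]$ and $\mathcal{L}(0)=0$; $\mathcal{L}^n$ is its $n$-th iterate. For $x\in[0,1]$, $\operatorname{AS}_{\mathcal{L}}(x)$ is the set of $y\in[0,1]$ with $y\ne x$ such that $\lim_{n\to\infty}|\mathcal{L}^n(x)-\mathcal{L}^n(y)|=0$. $\dim_{\mathrm H}$ denotes Hausdorff dimension. *)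

theory Defs
  imports "HOL-Analysis.Analysis"
begin

(* Contribution of one covering set.  As 0 powr 0 = 0 in HOL, the case s = 0 is
   separated so that nonempty sets count 1 and the zero-dimensional measure counts points. *)
definition hausdorff_gauge :: "real \<Rightarrow> 'a::metric_space set \<Rightarrow> ennreal" where
  "hausdorff_gauge s U =
     (if U = {} then 0 else if s = 0 then 1 else ennreal (diameter U powr s))"

(* Boundedness is required because diameter is only meaningful on bounded sets.  The
   sequences may contain empty sets, so finite covers are included. *)
definition hausdorff_pre :: "real \<Rightarrow> real \<Rightarrow> 'a::metric_space set \<Rightarrow> ennreal" where
  "hausdorff_pre s \<delta> A =
     Inf {(\<Sum>i. hausdorff_gauge s (U i)) | U :: nat \<Rightarrow> 'a set.
            A \<subseteq> (\<Union>i. U i) \<and> (\<forall>i. bounded (U i) \<and> diameter (U i) \<le> \<delta>)}"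

definition hausdorff_measure :: "real \<Rightarrow> 'a::metric_space set \<Rightarrow> ennreal" where
  "hausdorff_measure s A = (SUP \<delta>\<in>{0<..}. hausdorff_pre s \<delta> A)"

definition hausdorff_dim :: "'a::metric_space set \<Rightarrow> ennreal" where
  "hausdorff_dim A = Inf {ennreal s | s. 0 \<le> s \<and> hausdorff_measure s A = 0}"

definition luroth_digit :: "real \<Rightarrow> nat" where
  "luroth_digit x = (THE a. 2 \<le> a \<and> 1 / real a < x \<and> x \<le> 1 / (real a - 1))"

lemma luroth_digit_ex1:
  assumes "0 < x" "x \<le> 1"
  shows "\<exists>!a::nat. 2 \<le> a \<and> 1 / real a < x \<and> x \<le> 1 / (real a - 1)"
proof -
  have *: "(2 \<le> a \<and> 1 / real a < x \<and> x \<le> 1 / (real a - 1)) \<longleftrightarrow> int a = \<lfloor>1 / x\<rfloor> + 1"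
    for a :: nat
  proof -
    have ge: "1 \<le> \<lfloor>1 / x\<rfloor>"
      using assms by (simp add: le_floor_iff)
    show ?thesis
    proof (cases "2 \<le> a")
      case True
      then have pos: "0 < real a" "0 < real a - 1"
        by auto
      have "1 / real a < x \<longleftrightarrow> 1 / x < real a"
        using pos assms by (simp add: field_simps)
      moreover have "x \<le> 1 / (real a - 1) \<longleftrightarrow> real a - 1 \<le> 1 / x"
        using pos assms by (simp add: field_simps)
      moreover have "int a = \<lfloor>1 / x\<rfloor> + 1 \<longleftrightarrow> real a - 1 \<le> 1 / x \<and> 1 / x < real a"
        by linarith
      ultimately show ?thesis
        using True by blast
    next
      case False
      then show ?thesis
        using ge by linarith
    qed
  qed
  have "0 \<le> \<lfloor>1 / x\<rfloor> + 1"
    using assms by (simp add: add_nonneg_nonneg)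
  then show ?thesis
    unfolding * by (metis nat_eq_iff2)
qed

(* The formula is only intended on [0,1]; values elsewhere are irrelevant, since
   orbits of points of [0,1] stay there. *)
definition luroth :: "real \<Rightarrow> real" where
  "luroth x =
     (if x = 0 then 0
      else real (luroth_digit x) * (real (luroth_digit x) - 1) * x - (real (luroth_digit x) - 1))"

lemma luroth_in_unit:
  assumes "x \<in> {0..1}"
  shows "luroth x \<in> {0..1}"
proof (cases "x = 0")
  case True
  then show ?thesis
    by (simp add: luroth_def)
next
  case False
  define a where "a = luroth_digit x"
  from False assms have "0 < x" "x \<le> 1"
    by auto
  then have a: "2 \<le> a" "1 / real a < x" "x \<le> 1 / (real a - 1)"
    using theI'[OF luroth_digit_ex1[of x]] unfolding a_def luroth_digit_def by auto
  have pos: "0 < real a" "0 < real a - 1"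
    using a(1) by auto
  have "1 \<le> real a * x" "(real a - 1) * x \<le> 1"
    using a(2,3) pos by (simp_all add: field_simps)
  then have "(real a - 1) * 1 \<le> (real a - 1) * (real a * x)"
    "real a * ((real a - 1) * x) \<le> real a * 1"
    using pos by (auto intro!: mult_left_mono)
  then show ?thesis
    using False by (simp add: luroth_def a_def[symmetric] algebra_simps)
qed

definition luroth_AS :: "real \<Rightarrow> real set" where
  "luroth_AS x =
     {y \<in> {0..1}. y \<noteq> x \<and> (\<lambda>n. \<bar>(luroth ^^ n) x - (luroth ^^ n) y\<bar>) \<longlonglongrightarrow> 0}"

end

theory Submission
  imports Defs
begin

text \<open>Two points asymptotic to each other have eventually equal digits at all times when the first
  orbit stays above a fixed threshold, since otherwise a discontinuity of the map would send them
  to opposite ends of the interval. If the orbit is eventually above the threshold, expansion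
  forces the orbits to merge, and a point has only countably many iterated preimages. In general,
  every other digit is large. The cylinders given by these restrictions have small
  \<open>s\<close>-dimensional content for \<open>s > 1 / 2\<close>: a prescribed digit contributes a factor at most
  \<open>2 powr - s\<close>, and digits \<open>a \<ge> M\<close> contribute the tail of the convergent series
  \<open>(a * (a - 1)) powr - s\<close>. For the lower bound, the points whose \<open>n\<close>-th digit lies between
  \<open>2 ^ (n + 1)\<close> and \<open>2 ^ (n + 2)\<close> all have orbits tending to 0, and reading these digits as
  mixed radix digits maps them onto \<open>[0, 1)\<close>, Hoelder continuously for every exponent below
  \<open>1 / 2\<close>.\<close>

section \<open>Digits and inverse branches of the Lueroth map\<close>

definition luroth_branch :: "nat \<Rightarrow> real \<Rightarrow> real" where
  "luroth_branch a z = (z + real a - 1) / (real a * (real a - 1))"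

lemma luroth_digit_bounds:
  assumes "0 < x" "x \<le> 1"
  shows "2 \<le> luroth_digit x" "1 / real (luroth_digit x) < x" "x \<le> 1 / (real (luroth_digit x) - 1)"
  using theI'[OF luroth_digit_ex1[OF assms]] unfolding luroth_digit_def by auto

lemma luroth_digit_eqI:
  assumes "0 < x" "x \<le> 1" "2 \<le> a" "1 / real a < x" "x \<le> 1 / (real a - 1)"
  shows "luroth_digit x = a"
  using luroth_digit_ex1[OF assms(1,2)] luroth_digit_bounds[OF assms(1,2)] assms by blast

lemma luroth_branch_luroth:
  assumes "0 < x" "x \<le> 1"
  shows "luroth_branch (luroth_digit x) (luroth x) = x"
proof -
  have "real (luroth_digit x) \<ge> 2"
    using luroth_digit_bounds(1)[OF assms] by simp
  then show ?thesis
    using assms by (simp add: luroth_branch_def luroth_def field_simps)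
qed

text \<open>A digit interval excludes its left end \<open>1 / a\<close>, the only point that its
  branch would send to 0; so orbits starting away from 0 never reach 0 and have a digit at every
  time.\<close>

lemma luroth_pos:
  assumes "0 < x" "x \<le> 1"
  shows "0 < luroth x" "luroth x \<le> 1"
proof -
  define a where "a = real (luroth_digit x)"
  have a: "2 \<le> a" "1 / a < x"
    using luroth_digit_bounds[OF assms] by (simp_all add: a_def)
  then have "1 < a * x"
    by (simp add: field_simps)
  then have "(a - 1) * 1 < (a - 1) * (a * x)"
    using a by (intro mult_strict_left_mono) auto
  then show "0 < luroth x"
    using assms by (simp add: luroth_def a_def algebra_simps)
  show "luroth x \<le> 1"
    using luroth_in_unit[of x] assms by auto
qed

lemma luroth_branch_bounds:
  assumes "2 \<le> a" "0 < z" "z \<le> 1"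
  shows "1 / real a < luroth_branch a z" "luroth_branch a z \<le> 1 / (real a - 1)"
    "0 < luroth_branch a z" "luroth_branch a z \<le> 1"
proof -
  have a: "real a \<ge> 2"
    using assms by simp
  show 1: "1 / real a < luroth_branch a z"
    using a assms by (simp add: luroth_branch_def divide_simps)
  show 2: "luroth_branch a z \<le> 1 / (real a - 1)"
    using a assms by (simp add: luroth_branch_def divide_simps)
  have "0 < 1 / real a"
    using a by simp
  with 1 show "0 < luroth_branch a z"
    by linarith
  have "1 / (real a - 1) \<le> 1"
    using a by simp
  with 2 show "luroth_branch a z \<le> 1"
    by linarith
qed

lemma luroth_branch_inverse:
  assumes "2 \<le> a" "0 < z" "z \<le> 1"
  shows "luroth_digit (luroth_branch a z) = a" "luroth (luroth_branch a z) = z"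
proof -
  note b = luroth_branch_bounds[OF assms]
  show d: "luroth_digit (luroth_branch a z) = a"
    using b assms by (intro luroth_digit_eqI)
  have "real a \<ge> 2"
    using assms by simp
  then have "real a * (real a - 1) * luroth_branch a z = z + real a - 1"
    by (simp add: luroth_branch_def)
  then show "luroth (luroth_branch a z) = z"
    using b by (simp add: luroth_def d)
qed

lemma luroth_branch_altdef:
  assumes "2 \<le> a"
  shows "luroth_branch a z = 1 / real a + 1 / (real a * (real a - 1)) * z"
proof -
  have "real a * (real a - 1) \<noteq> 0"
    using assms by simp
  then show ?thesis
    by (simp add: luroth_branch_def divide_simps)
qed

lemma luroth_branch_diff:
  "luroth_branch a z - luroth_branch a w = (z - w) / (real a * (real a - 1))"
  by (simp add: luroth_branch_def diff_divide_distrib[symmetric])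

lemma luroth_funpow_in_unit:
  assumes "x \<in> {0..1}"
  shows "(luroth ^^ n) x \<in> {0..1}"
  using assms by (induction n) (simp_all add: luroth_in_unit del: atLeastAtMost_iff)

lemma luroth_funpow_pos:
  assumes "0 < x" "x \<le> 1"
  shows "0 < (luroth ^^ n) x" "(luroth ^^ n) x \<le> 1"
proof -
  have "0 < (luroth ^^ n) x \<and> (luroth ^^ n) x \<le> 1"
    using assms by (induction n) (simp_all add: luroth_pos)
  then show "0 < (luroth ^^ n) x" "(luroth ^^ n) x \<le> 1"
    by simp_all
qed

section \<open>Asymptotic points share the large part of the orbit\<close>

text \<open>Two close points with different digits lie on different sides of a discontinuity of the
  map, so the images of the smaller and of the larger are close to 1 and to 0, respectively.\<close>

lemma luroth_separation_aux:
  assumes "0 < \<delta>" "\<delta> \<le> u" "u \<le> 1" "\<delta> \<le> v" "v \<le> 1" "luroth_digit v < luroth_digit u"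
  shows "1 - 2 / \<delta>\<^sup>2 * \<bar>u - v\<bar> \<le> \<bar>luroth u - luroth v\<bar>"
proof -
  define a b where "a = real (luroth_digit u)" and "b = real (luroth_digit v)"
  have u: "0 < u" "u \<le> 1" and v: "0 < v" "v \<le> 1"
    using assms by auto
  have a: "2 \<le> a" "1 / a < u" "u \<le> 1 / (a - 1)"
    using luroth_digit_bounds[OF u] by (simp_all add: a_def)
  have b: "2 \<le> b" "1 / b < v" "v \<le> 1 / (b - 1)"
    using luroth_digit_bounds[OF v] by (simp_all add: b_def)
  \<comment> \<open>Points above \<open>\<delta>\<close> lie on branches of bounded slope:
    \<open>\<delta> * (c - 1) \<le> 1\<close>, and adding \<open>\<delta> \<le> 1\<close> gives
    \<open>\<delta> * c \<le> 2\<close>.\<close>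
  have bound: "c * (c - 1) \<le> 2 / \<delta>\<^sup>2" if "2 \<le> c" "w \<le> 1 / (c - 1)" "\<delta> \<le> w" for c w
  proof -
    have "\<delta> * (c - 1) \<le> w * (c - 1)"
      using that by (intro mult_right_mono) auto
    also have "\<dots> \<le> 1"
      using that by (simp add: pos_le_divide_eq)
    finally have "\<delta> * (c - 1) \<le> 1" .
    moreover have "\<delta> * c \<le> 2"
      using calculation assms by (simp add: algebra_simps)
    ultimately have "(\<delta> * c) * (\<delta> * (c - 1)) \<le> 2 * 1"
      using that assms(1) by (intro mult_mono) auto
    then show ?thesis
      using assms(1) by (simp add: field_simps power2_eq_square)
  qed
  have ab: "b \<le> a - 1"
    using assms(6) by (simp add: a_def b_def)
  \<comment> \<open>The cuts \<open>1 / (a - 1) \<le> 1 / b\<close> lie between \<open>u\<close> and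
    \<open>v\<close>, so the gaps from \<open>u\<close> up to the first and from the second up to
    \<open>v\<close> add up to at most \<open>\<bar>u - v\<bar>\<close>.\<close>
  have mid: "1 / (a - 1) \<le> 1 / b"
    using ab b by (simp add: frac_le)
  have "1 - luroth u = a * (a - 1) * (1 / (a - 1) - u)"
    using u a by (simp add: luroth_def a_def[symmetric] field_simps)
  also have "\<dots> \<le> 2 / \<delta>\<^sup>2 * (1 / (a - 1) - u)"
    using bound[OF a(1,3)] assms a by (intro mult_right_mono) auto
  finally have 1: "1 - luroth u \<le> 2 / \<delta>\<^sup>2 * (1 / (a - 1) - u)" .
  have "luroth v = b * (b - 1) * (v - 1 / b)"
    using v b by (simp add: luroth_def b_def[symmetric] field_simps)
  also have "\<dots> \<le> 2 / \<delta>\<^sup>2 * (v - 1 / b)"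
    using bound[OF b(1,3)] assms b by (intro mult_right_mono) auto
  finally have 2: "luroth v \<le> 2 / \<delta>\<^sup>2 * (v - 1 / b)" .
  have "1 - luroth u + luroth v \<le> 2 / \<delta>\<^sup>2 * (1 / (a - 1) - u + (v - 1 / b))"
    using 1 2 by (simp only: distrib_left add_mono)
  also have "\<dots> \<le> 2 / \<delta>\<^sup>2 * \<bar>u - v\<bar>"
    using mid assms(1) by (intro mult_left_mono) auto
  finally show ?thesis
    by linarith
qed

lemma luroth_separation:
  assumes "0 < \<delta>" "\<delta> \<le> u" "u \<le> 1" "\<delta> \<le> v" "v \<le> 1" "luroth_digit u \<noteq> luroth_digit v"
  shows "1 - 2 / \<delta>\<^sup>2 * \<bar>u - v\<bar> \<le> \<bar>luroth u - luroth v\<bar>"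
  using luroth_separation_aux[of \<delta> u v] luroth_separation_aux[of \<delta> v u] assms
  by (cases "luroth_digit v < luroth_digit u") (auto simp: abs_minus_commute)

lemma luroth_AS_close:
  assumes "y \<in> luroth_AS x" "0 < e"
  shows "\<forall>\<^sub>F n in sequentially. \<bar>(luroth ^^ n) x - (luroth ^^ n) y\<bar> < e"
  using assms order_tendstoD(2)[of "\<lambda>n. \<bar>(luroth ^^ n) x - (luroth ^^ n) y\<bar>" 0 sequentially e]
  by (simp add: luroth_AS_def)

text \<open>Different digits at a time when the orbit of \<open>x\<close> is above
  \<open>\<delta>\<close> would, by \<open>luroth_separation\<close>, put the next iterates more
  than 1/2 apart, whereas asymptotic orbits are eventually closer than that.\<close>

lemma luroth_AS_digit_eq:
  assumes "x \<in> {0..1}" "y \<in> luroth_AS x" "0 < \<delta>"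
  shows "\<forall>\<^sub>F n in sequentially. \<delta> \<le> (luroth ^^ n) x \<longrightarrow> 0 < (luroth ^^ n) y \<and>
           luroth_digit ((luroth ^^ n) y) = luroth_digit ((luroth ^^ n) x)"
proof -
  \<comment> \<open>The bound \<open>\<delta> / 2\<close> keeps the orbit of \<open>y\<close> above
    \<open>\<delta> / 2\<close>; the bound \<open>\<delta>\<^sup>2 / 32\<close> makes the error term
    in the separation at that level at most 1/4.\<close>
  define e where "e = min (\<delta> / 2) (\<delta>\<^sup>2 / 32)"
  have e: "0 < e" "e \<le> \<delta> / 2" "e \<le> \<delta>\<^sup>2 / 32"
    using assms(3) by (auto simp: e_def)
  have y: "y \<in> {0..1}"
    using assms(2) by (simp add: luroth_AS_def)
  have "\<forall>\<^sub>F n in sequentially. \<bar>(luroth ^^ Suc n) x - (luroth ^^ Suc n) y\<bar> < 1 / 2"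
    using luroth_AS_close[OF assms(2), of "1/2"] eventually_sequentially_Suc
      [of "\<lambda>n. \<bar>(luroth ^^ n) x - (luroth ^^ n) y\<bar> < 1 / 2"] by simp
  then show ?thesis
    using luroth_AS_close[OF assms(2) e(1)]
  proof eventually_elim
    case (elim n)
    define u v where "u = (luroth ^^ n) x" and "v = (luroth ^^ n) y"
    have uv: "u \<le> 1" "v \<le> 1"
      using luroth_funpow_in_unit[OF assms(1), of n] luroth_funpow_in_unit[OF y, of n]
      by (auto simp: u_def v_def)
    have close: "\<bar>u - v\<bar> < e" "\<bar>luroth u - luroth v\<bar> < 1 / 2"
      using elim by (simp_all add: u_def v_def)
    have "0 < v \<and> luroth_digit v = luroth_digit u" if "\<delta> \<le> u"
    proof
      have half: "0 < \<delta> / 2" "\<delta> / 2 \<le> u" "\<delta> / 2 \<le> v"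
        using that close(1) e assms(3) by linarith+
      then show "0 < v"
        by linarith
      have "2 / (\<delta> / 2)\<^sup>2 * \<bar>u - v\<bar> \<le> 2 / (\<delta> / 2)\<^sup>2 * (\<delta>\<^sup>2 / 32)"
        using close e by (intro mult_left_mono) auto
      also have "\<dots> = 1 / 4"
        using assms(3) by (simp add: power2_eq_square)
      finally show "luroth_digit v = luroth_digit u"
        using luroth_separation[OF half(1,2) uv(1) half(3) uv(2)] close(2) by linarith
    qed
    then show ?case
      by (simp add: u_def v_def)
  qed
qed

text \<open>A positive point is determined by its image and its digit, so each step backwards adds
  only a countable choice of branches and possibly the point 0.\<close>

lemma countable_luroth_funpow_vimage:
  "countable {y \<in> {0..1}. (luroth ^^ n) y = z}"
proof (induction n)
  case 0
  show ?case
    by (rule countable_subset[of _ "{z}"]) auto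
next
  case (Suc n)
  let ?S = "{y \<in> {0..1}. (luroth ^^ n) y = z}"
  have "{y \<in> {0..1}. (luroth ^^ Suc n) y = z} \<subseteq> insert 0 (\<Union>a. luroth_branch a ` ?S)"
  proof
    fix y :: real
    assume y: "y \<in> {y \<in> {0..1}. (luroth ^^ Suc n) y = z}"
    then have "luroth y \<in> ?S"
      using luroth_in_unit[of y] by (simp add: funpow_Suc_right del: funpow.simps)
    moreover have "y \<noteq> 0 \<Longrightarrow> luroth_branch (luroth_digit y) (luroth y) = y"
      using y by (intro luroth_branch_luroth) auto
    ultimately show "y \<in> insert 0 (\<Union>a. luroth_branch a ` ?S)"
      by (cases "y = 0") (auto intro!: exI[of _ "luroth_digit y"] image_eqI[of _ _ "luroth y"])
  qed
  then show ?case
    using Suc by (elim countable_subset) auto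
qed

text \<open>Points with the same digit move by the same affine branch, whose slope is at least 2.
  Their distance would thus double at each step, but it never exceeds 1.\<close>

lemma luroth_same_digits_imp_eq:
  assumes "\<And>n. 0 < (luroth ^^ n) x \<and> (luroth ^^ n) x \<le> 1"
    and "\<And>n. 0 < (luroth ^^ n) y \<and> (luroth ^^ n) y \<le> 1"
    and "\<And>n. luroth_digit ((luroth ^^ n) y) = luroth_digit ((luroth ^^ n) x)"
  shows "x = y"
proof -
  have exp: "2 ^ n * \<bar>x - y\<bar> \<le> \<bar>(luroth ^^ n) x - (luroth ^^ n) y\<bar>" for n
  proof (induction n)
    case (Suc n)
    define u v where "u = (luroth ^^ n) x" and "v = (luroth ^^ n) y"
    define a where "a = real (luroth_digit u)"
    have uv: "0 < u" "u \<le> 1" "0 < v" "v \<le> 1" "luroth_digit v = luroth_digit u"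
      using assms[of n] by (simp_all add: u_def v_def)
    have a: "2 \<le> a"
      using luroth_digit_bounds(1)[OF uv(1,2)] by (simp add: a_def)
    have "2 * 1 \<le> a * (a - 1)"
      using a by (intro mult_mono) auto
    then have "2 * \<bar>u - v\<bar> \<le> a * (a - 1) * \<bar>u - v\<bar>"
      by (intro mult_right_mono) auto
    also have "\<dots> = \<bar>a * (a - 1) * (u - v)\<bar>"
      using a by (simp add: abs_mult)
    also have "a * (a - 1) * (u - v) = luroth u - luroth v"
      using uv by (simp add: luroth_def a_def algebra_simps)
    finally show ?case
      using Suc by (simp add: u_def v_def)
  qed simp
  have "2 ^ n * \<bar>x - y\<bar> \<le> 1" for n
    using exp[of n] assms(1,2)[of n] by linarith
  then have "\<bar>x - y\<bar> \<le> (1 / 2) ^ n" for n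
    by (simp add: power_one_over pos_le_divide_eq mult.commute)
  moreover have "(\<lambda>n. (1 / 2 :: real) ^ n) \<longlonglongrightarrow> 0"
    by (simp add: LIMSEQ_power_zero)
  ultimately have "\<bar>x - y\<bar> \<le> 0"
    by (meson LIMSEQ_le_const)
  then show ?thesis
    by simp
qed

lemma countable_luroth_AS:
  assumes x: "x \<in> {0..1}" and lim: "liminf (\<lambda>n. ereal ((luroth ^^ n) x)) > 0"
  shows "countable (luroth_AS x)"
proof -
  obtain r where r: "0 < r" "ereal r < liminf (\<lambda>n. ereal ((luroth ^^ n) x))"
    using ereal_dense2[OF lim] by auto
  have ev: "\<forall>\<^sub>F n in sequentially. r \<le> (luroth ^^ n) x"
    using less_LiminfD[OF r(2)] by eventually_elim simp
  have "luroth_AS x \<subseteq> (\<Union>N. {y \<in> {0..1}. (luroth ^^ N) y = (luroth ^^ N) x})"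
  proof
    fix y
    assume y: "y \<in> luroth_AS x"
    then have y1: "y \<in> {0..1}"
      by (simp add: luroth_AS_def)
    have "\<forall>\<^sub>F n in sequentially. 0 < (luroth ^^ n) x \<and> 0 < (luroth ^^ n) y \<and>
           luroth_digit ((luroth ^^ n) y) = luroth_digit ((luroth ^^ n) x)"
      using ev luroth_AS_digit_eq[OF x y r(1)] by eventually_elim (use r in auto)
    then obtain N where N: "\<And>n. n \<ge> N \<Longrightarrow> 0 < (luroth ^^ n) x \<and> 0 < (luroth ^^ n) y \<and>
           luroth_digit ((luroth ^^ n) y) = luroth_digit ((luroth ^^ n) x)"
      by (auto simp: eventually_sequentially)
    have shift: "(luroth ^^ n) ((luroth ^^ N) w) = (luroth ^^ (n + N)) w" for n w
      by (simp add: funpow_add)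
    have "(luroth ^^ N) x = (luroth ^^ N) y"
      using N[of "_ + N"] luroth_funpow_in_unit[OF x] luroth_funpow_in_unit[OF y1]
      by (intro luroth_same_digits_imp_eq) (auto simp: shift)
    then show "y \<in> (\<Union>N. {y \<in> {0..1}. (luroth ^^ N) y = (luroth ^^ N) x})"
      using y1 by (auto intro: exI[of _ N])
  qed
  then show ?thesis
    by (rule countable_subset) (intro countable_UN countable_luroth_funpow_vimage; simp)
qed

section \<open>Sets of Hausdorff measure zero\<close>

lemma ennreal_pos_real_less:
  fixes e :: ennreal
  assumes "0 < e"
  shows "\<exists>r>0. ennreal r < e"
proof -
  obtain z where z: "0 < z" "z < e"
    using dense[OF assms] by blast
  then obtain r where "z = ennreal r"
    using less_top_ennreal order.strict_trans2[OF z(2) top_greatest] by blast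
  then show ?thesis
    using z by (intro exI[of _ r]) (auto simp: ennreal_less_zero_iff)
qed

lemma hausdorff_pre_le:
  assumes "A \<subseteq> (\<Union>i. U i)" "\<And>i. bounded (U i) \<and> diameter (U i) \<le> \<delta>"
  shows "hausdorff_pre s \<delta> A \<le> (\<Sum>i. hausdorff_gauge s (U i))"
  unfolding hausdorff_pre_def using assms by (intro Inf_lower) auto

text \<open>The supremum over scales vanishes iff each premeasure does, and an infimum of costs
  vanishes iff there are arbitrarily cheap covers. Null sets are handled below only through such
  covers.\<close>

lemma hausdorff_null_iff:
  "hausdorff_measure s A = 0 \<longleftrightarrow>
    (\<forall>\<delta>>0. \<forall>e>0. \<exists>U :: nat \<Rightarrow> 'a::metric_space set. A \<subseteq> (\<Union>i. U i) \<and>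
       (\<forall>i. bounded (U i) \<and> diameter (U i) \<le> \<delta>) \<and> (\<Sum>i. hausdorff_gauge s (U i)) < e)"
    (is "_ \<longleftrightarrow> ?R")
proof
  assume "hausdorff_measure s A = 0"
  then have "hausdorff_pre s \<delta> A = 0" if "0 < \<delta>" for \<delta>
    using that by (simp add: hausdorff_measure_def SUP_eq_iff bot_ennreal[symmetric])
  then have pre: "hausdorff_pre s \<delta> A < e" if "0 < \<delta>" "0 < e" for \<delta> e
    using that by simp
  show ?R
  proof (intro allI impI)
    fix \<delta> :: real and e :: ennreal
    assume "0 < \<delta>" "0 < e"
    then show "\<exists>U :: nat \<Rightarrow> 'a set. A \<subseteq> (\<Union>i. U i) \<and>
       (\<forall>i. bounded (U i) \<and> diameter (U i) \<le> \<delta>) \<and> (\<Sum>i. hausdorff_gauge s (U i)) < e"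
      using pre[of \<delta> e] unfolding hausdorff_pre_def Inf_less_iff by auto
  qed
next
  assume R: ?R
  have "hausdorff_pre s \<delta> A = 0" if "0 < \<delta>" for \<delta>
  proof -
    have "hausdorff_pre s \<delta> A \<le> e" if "0 < e" for e
    proof -
      obtain U :: "nat \<Rightarrow> 'a set" where "A \<subseteq> (\<Union>i. U i)"
        "\<forall>i. bounded (U i) \<and> diameter (U i) \<le> \<delta>" "(\<Sum>i. hausdorff_gauge s (U i)) < e"
        using R[rule_format, OF \<open>0 < \<delta>\<close> \<open>0 < e\<close>] by (elim exE conjE)
      then show ?thesis
        using hausdorff_pre_le[of A U \<delta> s] by auto
    qed
    then show ?thesis
      using dense[of 0 "hausdorff_pre s \<delta> A"] by (auto simp: not_less[symmetric] zero_less_iff_neq_zero)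
  qed
  then show "hausdorff_measure s A = 0"
    by (simp add: hausdorff_measure_def)
qed

lemma hausdorff_null_mono:
  assumes "hausdorff_measure s B = 0" "A \<subseteq> B"
  shows "hausdorff_measure s A = 0"
  unfolding hausdorff_null_iff
proof (intro allI impI)
  fix \<delta> :: real and e :: ennreal
  assume "0 < \<delta>" "0 < e"
  then obtain U where "B \<subseteq> (\<Union>i. U i)" "\<forall>i. bounded (U i) \<and> diameter (U i) \<le> \<delta>"
      "(\<Sum>i. hausdorff_gauge s (U i)) < e"
    using assms(1) unfolding hausdorff_null_iff by blast
  then show "\<exists>U. A \<subseteq> (\<Union>i. U i) \<and> (\<forall>i. bounded (U i) \<and> diameter (U i) \<le> \<delta>) \<and>
      (\<Sum>i. hausdorff_gauge s (U i)) < e"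
    using assms(2) by (intro exI[of _ U]) auto
qed

lemma hausdorff_null_UN:
  fixes A :: "nat \<Rightarrow> 'a::metric_space set"
  assumes "\<And>n. hausdorff_measure s (A n) = 0"
  shows "hausdorff_measure s (\<Union>n. A n) = 0"
  unfolding hausdorff_null_iff
proof (intro allI impI)
  fix \<delta> :: real and e :: ennreal
  assume \<delta>: "0 < \<delta>" and e: "0 < e"
  obtain r where r: "0 < r" "ennreal r < e"
    using ennreal_pos_real_less[OF e] by blast
  \<comment> \<open>The \<open>n\<close>-th set gets the budget \<open>r / 2 ^ (n + 1)\<close>;
    these budgets sum to \<open>r\<close>.\<close>
  have "\<forall>n. \<exists>U. A n \<subseteq> (\<Union>i. U i) \<and> (\<forall>i. bounded (U i) \<and> diameter (U i) \<le> \<delta>) \<and>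
      (\<Sum>i. hausdorff_gauge s (U i)) < ennreal (r * (1 / 2) ^ Suc n)"
    using assms \<delta> r unfolding hausdorff_null_iff by simp
  then obtain U where U: "\<And>n. A n \<subseteq> (\<Union>i. U n i)"
      "\<And>n i. bounded (U n i) \<and> diameter (U n i) \<le> \<delta>"
      "\<And>n. (\<Sum>i. hausdorff_gauge s (U n i)) < ennreal (r * (1 / 2) ^ Suc n)"
    by metis
  \<comment> \<open>The pairing function merges the double family of covering sets into a single
    sequence, as the definition of the premeasure demands.\<close>
  define V where "V = (\<lambda>k. case prod_decode k of (n, i) \<Rightarrow> U n i)"
  have V: "V (prod_encode (n, i)) = U n i" for n i
    by (simp add: V_def)
  have "(\<Union>n. A n) \<subseteq> (\<Union>k. V k)"
  proof
    fix a
    assume "a \<in> (\<Union>n. A n)"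
    then obtain n i where "a \<in> U n i"
      using U(1) by blast
    then show "a \<in> (\<Union>k. V k)"
      by (intro UN_I[of "prod_encode (n, i)"]) (simp_all add: V)
  qed
  moreover have "bounded (V k) \<and> diameter (V k) \<le> \<delta>" for k
    using U(2) by (simp add: V_def split: prod.split)
  moreover have "(\<Sum>k. hausdorff_gauge s (V k)) < e"
  proof -
    have "(\<Sum>k. hausdorff_gauge s (V k)) =
        (\<Sum>k. (\<lambda>(n, i). hausdorff_gauge s (U n i)) (prod_decode k))"
      by (simp add: V_def case_prod_unfold)
    also have "\<dots> = (\<Sum>n. \<Sum>i. hausdorff_gauge s (U n i))"
      by (rule suminf_ennreal_2dimen) simp
    also have "\<dots> \<le> (\<Sum>n. ennreal (r * (1 / 2) ^ Suc n))"
      using U(3) by (intro suminf_le) (auto intro: less_imp_le)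
    also have "\<dots> = ennreal (r * 1)"
      using r(1) by (intro suminf_ennreal_eq sums_mult power_half_series) auto
    finally show ?thesis
      using r(2) by simp
  qed
  ultimately show "\<exists>V. (\<Union>n. A n) \<subseteq> (\<Union>i. V i) \<and> (\<forall>i. bounded (V i) \<and> diameter (V i) \<le> \<delta>) \<and>
      (\<Sum>i. hausdorff_gauge s (V i)) < e"
    by blast
qed

lemma hausdorff_null_singleton:
  assumes "0 < s"
  shows "hausdorff_measure s {a} = 0"
  unfolding hausdorff_null_iff
proof (intro allI impI exI conjI)
  show "(\<Sum>i::nat. hausdorff_gauge s {a}) < e" if "0 < e" for e
    using that assms by (simp add: hausdorff_gauge_def)
qed auto

section \<open>Covering by cylinders\<close>

text \<open>The sum of the \<open>s\<close>-th powers of the contraction ratios of the inverse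
  branches with digit in \<open>D\<close>, taken in \<open>ennreal\<close> so that divergence needs
  no separate treatment.\<close>

definition luroth_weight :: "real \<Rightarrow> nat set \<Rightarrow> ennreal" where
  "luroth_weight s D =
     (\<Sum>a. if 2 \<le> a \<and> a \<in> D then ennreal ((real a * (real a - 1)) powr - s) else 0)"

lemma luroth_branch_image_diameter:
  assumes "2 \<le> a" "bounded V"
  shows "bounded (luroth_branch a ` V)"
    and "diameter (luroth_branch a ` V) \<le> diameter V / (real a * (real a - 1))"
proof -
  define p where "p = real a * (real a - 1)"
  have p: "0 < p"
    using assms by (simp add: p_def)
  have d: "dist (luroth_branch a z) (luroth_branch a w) = dist z w / p" for z w
    using p by (simp add: dist_real_def luroth_branch_diff p_def)
  have diam: "dist u v \<le> diameter V / p"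
    if "u \<in> luroth_branch a ` V" "v \<in> luroth_branch a ` V" for u v
    using that p diameter_bounded_bound[OF assms(2)] by (auto simp: d divide_right_mono)
  then show "bounded (luroth_branch a ` V)"
    by (auto simp: bounded_two_points)
  show "diameter (luroth_branch a ` V) \<le> diameter V / (real a * (real a - 1))"
    using diam p diameter_ge_0[OF assms(2)] unfolding p_def[symmetric]
    by (intro diameter_le) (auto simp: dist_norm)
qed

lemma hausdorff_gauge_branch_image:
  assumes "2 \<le> a" "bounded V" "0 < s"
  shows "hausdorff_gauge s (luroth_branch a ` V)
           \<le> ennreal ((real a * (real a - 1)) powr - s) * hausdorff_gauge s V"
proof -
  define p where "p = real a * (real a - 1)"
  have p: "0 < p"
    using assms by (simp add: p_def)
  have "diameter (luroth_branch a ` V) powr s \<le> (diameter V / p) powr s"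
    using luroth_branch_image_diameter[OF assms(1,2)] assms(3) diameter_ge_0
    by (intro powr_mono2) (auto simp: p_def)
  also have "\<dots> = p powr - s * diameter V powr s"
    using p diameter_ge_0[OF assms(2)] by (simp add: powr_divide powr_minus field_simps)
  finally show ?thesis
    using assms(3) by (simp add: hausdorff_gauge_def p_def ennreal_mult'[symmetric] ennreal_leI)
qed

text \<open>A cover for the digit restrictions shifted by one is pulled back through every branch
  allowed by \<open>D 0\<close>. This at least halves the diameters and multiplies the total cost by
  at most the weight of \<open>D 0\<close>.\<close>

lemma luroth_cylinder_cover:
  assumes "0 < s"
  shows "\<exists>U :: nat \<Rightarrow> real set.
    {y \<in> {0<..1}. \<forall>i<k. luroth_digit ((luroth ^^ i) y) \<in> D i} \<subseteq> (\<Union>i. U i) \<and>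
    (\<forall>i. bounded (U i) \<and> diameter (U i) \<le> (1 / 2) ^ k) \<and>
    (\<Sum>i. hausdorff_gauge s (U i)) \<le> (\<Prod>i<k. luroth_weight s (D i))"
proof (induction k arbitrary: D)
  case 0
  define U where "U = (\<lambda>i::nat. if i = 0 then {0..1::real} else {})"
  have "(\<Sum>i. hausdorff_gauge s (U i)) = (\<Sum>i\<in>{0}. hausdorff_gauge s (U i))"
    by (rule suminf_finite) (auto simp: U_def hausdorff_gauge_def)
  also have "\<dots> \<le> 1"
    using assms by (simp add: U_def hausdorff_gauge_def)
  finally show ?case
    by (intro exI[of _ U]) (auto simp: U_def)
next
  case (Suc k)
  obtain V :: "nat \<Rightarrow> real set" where V:
    "{y \<in> {0<..1}. \<forall>i<k. luroth_digit ((luroth ^^ i) y) \<in> D (Suc i)} \<subseteq> (\<Union>i. V i)"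
    "\<And>i. bounded (V i)" "\<And>i. diameter (V i) \<le> (1 / 2) ^ k"
    "(\<Sum>i. hausdorff_gauge s (V i)) \<le> (\<Prod>i<k. luroth_weight s (D (Suc i)))"
    using Suc[of "\<lambda>i. D (Suc i)"] by blast
  \<comment> \<open>Forbidden pairs give the empty set, which costs nothing; \<open>U\<close> below
    enumerates all pairs of a branch and a set of the old cover.\<close>
  define G where "G = (\<lambda>(a, i). if 2 \<le> a \<and> a \<in> D 0 then luroth_branch a ` V i else {})"
  define w where "w = (\<lambda>a. if 2 \<le> a \<and> a \<in> D 0 then ennreal ((real a * (real a - 1)) powr - s) else 0)"
  define U where "U = (\<lambda>j. G (prod_decode j))"
  have "{y \<in> {0<..1}. \<forall>i<Suc k. luroth_digit ((luroth ^^ i) y) \<in> D i} \<subseteq> (\<Union>j. U j)"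
  proof
    fix y
    assume "y \<in> {y \<in> {0<..1}. \<forall>i<Suc k. luroth_digit ((luroth ^^ i) y) \<in> D i}"
    then have y: "0 < y" "y \<le> 1" and
      dig: "\<And>i. i < Suc k \<Longrightarrow> luroth_digit ((luroth ^^ i) y) \<in> D i"
      by auto
    have "luroth_digit ((luroth ^^ i) (luroth y)) \<in> D (Suc i)" if "i < k" for i
      using dig[of "Suc i"] that by (simp add: funpow_swap1)
    then obtain i where i: "luroth y \<in> V i"
      using V(1) luroth_pos[OF y] by auto
    have "y \<in> G (luroth_digit y, i)"
      using dig[of 0] i luroth_digit_bounds(1)[OF y] luroth_branch_luroth[OF y]
      by (auto simp: G_def intro!: image_eqI[of _ _ "luroth y"])
    then have "y \<in> U (prod_encode (luroth_digit y, i))"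
      by (simp add: U_def)
    then show "y \<in> (\<Union>j. U j)"
      by blast
  qed
  moreover have "bounded (U j) \<and> diameter (U j) \<le> (1 / 2) ^ Suc k" for j
  proof -
    obtain a i where j: "prod_decode j = (a, i)"
      by fastforce
    show ?thesis
    proof (cases "2 \<le> a \<and> a \<in> D 0")
      case True
      then have "2 * 1 \<le> real a * (real a - 1)"
        by (intro mult_mono) auto
      then have le: "diameter (V i) / (real a * (real a - 1)) \<le> (1 / 2) ^ Suc k"
        using frac_le[of "(1 / 2) ^ k" "diameter (V i)" 2 "real a * (real a - 1)"] V(3)[of i] by simp
      then show ?thesis
        using luroth_branch_image_diameter[of a "V i", OF _ V(2)] True
          order_trans[OF _ le] by (simp add: U_def G_def j del: power_Suc times_divide_eq_right)
    qed (auto simp: U_def G_def j)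
  qed
  moreover have "(\<Sum>j. hausdorff_gauge s (U j)) \<le> (\<Prod>i<Suc k. luroth_weight s (D i))"
  proof -
    have "(\<Sum>j. hausdorff_gauge s (U j)) = (\<Sum>a. \<Sum>i. hausdorff_gauge s (G (a, i)))"
      unfolding U_def by (rule suminf_ennreal_2dimen[where f = "\<lambda>p. hausdorff_gauge s (G p)"]) simp
    also have "\<dots> \<le> (\<Sum>a. \<Sum>i. w a * hausdorff_gauge s (V i))"
      using hausdorff_gauge_branch_image[OF _ V(2) assms]
      by (intro suminf_le) (auto simp: G_def w_def hausdorff_gauge_def[of _ "{}"])
    also have "\<dots> = luroth_weight s (D 0) * (\<Sum>i. hausdorff_gauge s (V i))"
      by (simp add: luroth_weight_def w_def)
    also have "\<dots> \<le> luroth_weight s (D 0) * (\<Prod>i<k. luroth_weight s (D (Suc i)))"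
      using V(4) by (intro mult_left_mono) auto
    finally show ?thesis
      by (simp add: prod.lessThan_Suc_shift del: prod.lessThan_Suc)
  qed
  ultimately show ?case
    by blast
qed

lemma luroth_weight_singleton_le:
  assumes "0 < s"
  shows "luroth_weight s {d} \<le> ennreal (2 powr - s)"
proof -
  have "luroth_weight s {d} = (\<Sum>a\<in>{d}. if 2 \<le> a \<and> a \<in> {d} then ennreal ((real a * (real a - 1)) powr - s) else 0)"
    unfolding luroth_weight_def by (rule suminf_finite) auto
  moreover have "(real d * (real d - 1)) powr - s \<le> 2 powr - s" if "2 \<le> d"
  proof -
    have "2 * 1 \<le> real d * (real d - 1)"
      using that by (intro mult_mono) auto
    then show ?thesis
      using assms by (intro powr_mono2') auto
  qed
  ultimately show ?thesis
    by (simp add: ennreal_leI)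
qed

text \<open>The source of the exponent 1/2: since \<open>a * (a - 1) \<ge> a\<^sup>2 / 2\<close>,
  the terms are at most \<open>2 powr s * a powr (- 2 * s)\<close>, which is summable for
  \<open>2 * s > 1\<close>.\<close>

lemma luroth_weight_summable:
  assumes "1 / 2 < s"
  shows "summable (\<lambda>a::nat. if 2 \<le> a then (real a * (real a - 1)) powr - s else 0)"
proof (rule summable_comparison_test')
  show "summable (\<lambda>a::nat. 2 powr s * real a powr (- 2 * s))"
    using assms by (intro summable_mult) (simp add: summable_real_powr_iff)
  show "norm (if 2 \<le> n then (real n * (real n - 1)) powr - s else 0) \<le> 2 powr s * real n powr (- 2 * s)"
    if "0 \<le> n" for n :: nat
  proof (cases "2 \<le> n")
    case True
    have "(real n * (real n - 1)) powr - s \<le> (real n powr 2 / 2) powr - s"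
      using True assms by (intro powr_mono2') (auto simp: power2_eq_square)
    also have "\<dots> = 2 powr s * real n powr (- 2 * s)"
      using True by (subst powr_divide) (auto simp: powr_powr powr_minus divide_simps simp flip: powr_numeral)
    finally show ?thesis
      using True by simp
  qed simp
qed

lemma luroth_weight_finite:
  assumes "1 / 2 < s"
  shows "luroth_weight s D < top"
proof -
  define g where "g = (\<lambda>a::nat. if 2 \<le> a then (real a * (real a - 1)) powr - s else 0)"
  have "luroth_weight s D \<le> (\<Sum>a. ennreal (g a))"
    unfolding luroth_weight_def by (intro suminf_le) (auto simp: g_def)
  also have "\<dots> = ennreal (\<Sum>a. g a)"
    using luroth_weight_summable[OF assms] by (intro suminf_ennreal2) (auto simp: g_def)
  finally show ?thesis
    using ennreal_less_top le_less_trans by blast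
qed

lemma luroth_weight_tail:
  assumes "1 / 2 < s" "0 < e"
  shows "\<exists>M. luroth_weight s {M..} \<le> ennreal e"
proof -
  define g where "g = (\<lambda>a::nat. if 2 \<le> a then (real a * (real a - 1)) powr - s else 0)"
  have g: "summable g" "\<And>a. 0 \<le> g a"
    using luroth_weight_summable[OF assms(1)] by (auto simp: g_def)
  obtain M where M: "norm (\<Sum>i. g (i + M)) < e"
    using suminf_exist_split[OF assms(2) g(1)] by blast
  define h where "h = (\<lambda>a. if M \<le> a then g a else 0)"
  have h: "summable h" "\<And>a. 0 \<le> h a"
    using g by (auto simp: h_def intro: summable_comparison_test'[OF g(1)])
  have "luroth_weight s {M..} = (\<Sum>a. ennreal (h a))"
    unfolding luroth_weight_def by (intro suminf_cong) (auto simp: g_def h_def)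
  also have "\<dots> = ennreal (\<Sum>a. h a)"
    using h by (rule suminf_ennreal2[rotated])
  also have "(\<Sum>a. h a) = (\<Sum>i. g (i + M))"
    using suminf_split_initial_segment[OF h(1), of M] by (simp add: h_def)
  finally show ?thesis
    using M by (intro exI[of _ M]) (auto intro: ennreal_leI)
qed

text \<open>The first \<open>N\<close> positions cost a finite factor \<open>c\<close> and each
  later one at most \<open>q < 1\<close>. So the cylinder covers of depth \<open>N + k\<close> cost
  at most \<open>c * q ^ k\<close>, while their mesh also tends to 0.\<close>

lemma hausdorff_null_digit_restricted:
  assumes "1 / 2 < s" "\<And>n. N \<le> n \<Longrightarrow> luroth_weight s (D n) \<le> ennreal q" "0 < q" "q < 1"
  shows "hausdorff_measure s {y \<in> {0<..1}. \<forall>i. luroth_digit ((luroth ^^ i) y) \<in> D i} = 0"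
  unfolding hausdorff_null_iff
proof (intro allI impI)
  fix \<delta> :: real and e :: ennreal
  assume \<delta>: "0 < \<delta>" and e: "0 < e"
  define P where "P = (\<Prod>i<N. luroth_weight s (D i))"
  have "P < top"
    unfolding P_def using luroth_weight_finite[OF assms(1)] by (simp add: ennreal_prod_eq_top less_top[symmetric])
  then obtain c where c: "0 \<le> c" "P = ennreal c"
    by (metis less_top_ennreal)
  have prod: "(\<Prod>i<N + k. luroth_weight s (D i)) \<le> ennreal (c * q ^ k)" for k
  proof (induction k)
    case 0
    then show ?case
      using c by (simp add: P_def)
  next
    case (Suc k)
    then have "(\<Prod>i<N + k. luroth_weight s (D i)) * luroth_weight s (D (N + k))
        \<le> ennreal (c * q ^ k) * ennreal q"
      using assms(2) by (intro mult_mono) auto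
    then show ?case
      using c assms(3) by (simp add: ennreal_mult[symmetric] mult_ac)
  qed
  have "(\<lambda>k. c * q ^ k) \<longlonglongrightarrow> c * 0"
    using assms by (intro tendsto_intros LIMSEQ_power_zero) auto
  then have "(\<lambda>k. ennreal (c * q ^ k)) \<longlonglongrightarrow> ennreal 0"
    by (intro tendsto_ennrealI) simp
  then have 1: "\<forall>\<^sub>F k in sequentially. ennreal (c * q ^ k) < e"
    using e by (intro order_tendstoD(2)) auto
  have "(\<lambda>k. (1 / 2 :: real) ^ k) \<longlonglongrightarrow> 0"
    by (intro LIMSEQ_power_zero) auto
  then have 2: "\<forall>\<^sub>F k in sequentially. (1 / 2 :: real) ^ k < \<delta>"
    using \<delta> by (intro order_tendstoD(2))
  obtain k where k: "ennreal (c * q ^ k) < e" "(1 / 2 :: real) ^ k < \<delta>"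
    using eventually_happens[OF eventually_conj[OF 1 2]] by auto
  have "(1 / 2 :: real) ^ (N + k) \<le> (1 / 2) ^ k"
    by (intro power_decreasing) auto
  with k have k': "(1 / 2 :: real) ^ (N + k) \<le> \<delta>"
    by linarith
  obtain U :: "nat \<Rightarrow> real set" where U:
    "{y \<in> {0<..1}. \<forall>i<N + k. luroth_digit ((luroth ^^ i) y) \<in> D i} \<subseteq> (\<Union>i. U i)"
    "\<And>i. bounded (U i)" "\<And>i. diameter (U i) \<le> (1 / 2) ^ (N + k)"
    "(\<Sum>i. hausdorff_gauge s (U i)) \<le> (\<Prod>i<N + k. luroth_weight s (D i))"
    using luroth_cylinder_cover[of s "N + k" D] assms(1) by auto
  have "(\<Sum>i. hausdorff_gauge s (U i)) < e"
    using U(4) prod[of k] k(1) by order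
  moreover have "{y \<in> {0<..1}. \<forall>i. luroth_digit ((luroth ^^ i) y) \<in> D i} \<subseteq> (\<Union>i. U i)"
    using U(1) by blast
  ultimately show "\<exists>U. {y \<in> {0<..1}. \<forall>i. luroth_digit ((luroth ^^ i) y) \<in> D i} \<subseteq> (\<Union>i. U i) \<and>
      (\<forall>i. bounded (U i) \<and> diameter (U i) \<le> \<delta>) \<and> (\<Sum>i. hausdorff_gauge s (U i)) < e"
    using U(2,3) k' order_trans by blast
qed

section \<open>The upper bound for the dimension of the asymptotic set\<close>

lemma hausdorff_null_luroth_AS:
  assumes x: "x \<in> {0..1}" and s: "1 / 2 < s"
  shows "hausdorff_measure s (luroth_AS x) = 0"
proof -
  define q :: real where "q = 2 powr - s"
  have q: "0 < q" "q < 1"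
    using s powr_less_mono[of "- s" 0 2] by (auto simp: q_def)
  \<comment> \<open>The factor \<open>q\<close> bounds the weight of a prescribed digit; the tail is
    cut so that large digits obey the same bound. Passing to \<open>K = Suc M\<close> makes the
    reciprocal of \<open>K\<close> meaningful.\<close>
  obtain M where M: "luroth_weight s {M..} \<le> ennreal q"
    using luroth_weight_tail[OF s q(1)] by blast
  define K where "K = Suc M"
  have "luroth_weight s {K..} \<le> luroth_weight s {M..}"
    unfolding luroth_weight_def by (intro suminf_le) (auto simp: K_def)
  with M have K: "luroth_weight s {K..} \<le> ennreal q" "0 < real K"
    by (auto simp: K_def)
  \<comment> \<open>Up to time \<open>N\<close> any digit is allowed; afterwards the digit of
    \<open>x\<close> is forced where the orbit of \<open>x\<close> is large, and a digit at least
    \<open>K\<close> where it is small.\<close>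
  define D where "D = (\<lambda>N n. if n < N then UNIV
      else if 1 / (2 * real K) \<le> (luroth ^^ n) x then {luroth_digit ((luroth ^^ n) x)} else {K..})"
  define A where "A = (\<lambda>N. {y \<in> {0<..1}. \<forall>i. luroth_digit ((luroth ^^ i) y) \<in> D N i})"
  have null: "hausdorff_measure s (A N) = 0" for N
    unfolding A_def
    using s q K luroth_weight_singleton_le[of s]
    by (intro hausdorff_null_digit_restricted[where N = N and q = q]) (auto simp: D_def q_def)
  \<comment> \<open>The index 0 is reserved for the point 0, which has no digits and so belongs to
    no \<open>A N\<close>.\<close>
  have "luroth_AS x \<subseteq> (\<Union>n. case n of 0 \<Rightarrow> {0} | Suc N \<Rightarrow> A N)"
  proof
    fix y
    assume y: "y \<in> luroth_AS x"
    then have y01: "y \<in> {0..1}"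
      by (simp add: luroth_AS_def)
    show "y \<in> (\<Union>n. case n of 0 \<Rightarrow> {0} | Suc N \<Rightarrow> A N)"
    proof (cases "y = 0")
      case True
      then show ?thesis
        by (intro UN_I[of 0]) auto
    next
      case False
      then have pos: "0 < y" "y \<le> 1"
        using y01 by auto
      define \<delta> where "\<delta> = 1 / (2 * real K)"
      have \<delta>: "0 < \<delta>" "2 * \<delta> = 1 / real K"
        using K by (auto simp: \<delta>_def)
      have "\<forall>\<^sub>F n in sequentially. if \<delta> \<le> (luroth ^^ n) x
          then luroth_digit ((luroth ^^ n) y) = luroth_digit ((luroth ^^ n) x)
          else K \<le> luroth_digit ((luroth ^^ n) y)"
        using luroth_AS_digit_eq[OF x y \<delta>(1)] luroth_AS_close[OF y \<delta>(1)]
      proof eventually_elim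
        case (elim n)
        define v where "v = (luroth ^^ n) y"
        have v: "0 < v" "v \<le> 1"
          using luroth_funpow_pos[OF pos, of n] by (auto simp: v_def)
        \<comment> \<open>The iterate of \<open>y\<close> is within \<open>\<delta>\<close> of one
          below \<open>\<delta>\<close>, hence below \<open>2 * \<delta> = 1 / K\<close>, which
          forces a large digit.\<close>
        have "K \<le> luroth_digit v" if "(luroth ^^ n) x < \<delta>"
        proof -
          have "v < 1 / real K"
            using that elim(2) \<delta>(2) by (simp add: v_def)
          then have "1 / real (luroth_digit v) < 1 / real K"
            using luroth_digit_bounds(2)[OF v] by linarith
          moreover have "0 < real (luroth_digit v)"
            using luroth_digit_bounds(1)[OF v] by simp
          ultimately show ?thesis
            using K(2) by (simp add: field_simps)
        qed
        then show ?case
          using elim(1) by (simp add: v_def)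
      qed
      then obtain N where "\<And>n. N \<le> n \<Longrightarrow> if \<delta> \<le> (luroth ^^ n) x
          then luroth_digit ((luroth ^^ n) y) = luroth_digit ((luroth ^^ n) x)
          else K \<le> luroth_digit ((luroth ^^ n) y)"
        by (auto simp: eventually_sequentially)
      then have "luroth_digit ((luroth ^^ n) y) \<in> D N n" for n
        by (cases "n < N") (force simp: D_def \<delta>_def[symmetric] not_less split: if_splits)+
      then have "y \<in> A N"
        using pos by (simp add: A_def)
      then show ?thesis
        by (intro UN_I[of "Suc N"]) auto
    qed
  qed
  moreover have "hausdorff_measure s (\<Union>n. case n of 0 \<Rightarrow> {0} | Suc N \<Rightarrow> A N) = 0"
    using s null by (intro hausdorff_null_UN) (simp add: hausdorff_null_singleton split: nat.split)
  ultimately show ?thesis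
    by (rule hausdorff_null_mono[rotated])
qed

lemma hausdorff_dim_luroth_AS_le:
  assumes "x \<in> {0..1}"
  shows "hausdorff_dim (luroth_AS x) \<le> ennreal (1 / 2)"
proof (rule ennreal_le_epsilon)
  fix e :: real
  assume "0 < e"
  then have "hausdorff_dim (luroth_AS x) \<le> ennreal (1 / 2 + e)"
    unfolding hausdorff_dim_def
    by (intro Inf_lower CollectI exI[of _ "1 / 2 + e"] conjI hausdorff_null_luroth_AS assms refl) auto
  then show "hausdorff_dim (luroth_AS x) \<le> ennreal (1 / 2) + ennreal e"
    using ennreal_plus[of "1 / 2" e] \<open>0 < e\<close> by (simp del: ennreal_plus)
qed

section \<open>Points with prescribed digits\<close>

text \<open>The Lueroth series with digits \<open>d\<close>, obtained by iterating
  \<open>x = 1 / a + luroth x / (a * (a - 1))\<close>, where \<open>a\<close> is the digit of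
  \<open>x\<close>.\<close>

definition luroth_point :: "(nat \<Rightarrow> nat) \<Rightarrow> real" where
  "luroth_point d =
     (\<Sum>n. 1 / real (d n) * (\<Prod>i<n. 1 / (real (d i) * (real (d i) - 1))))"

lemma luroth_point_series:
  assumes d: "\<And>i. 2 \<le> d i"
  shows "summable (\<lambda>n. 1 / real (d n) * (\<Prod>i<n. 1 / (real (d i) * (real (d i) - 1))))"
    and "0 \<le> luroth_point d" "luroth_point d \<le> 1"
proof -
  define p where "p = (\<lambda>n. \<Prod>i<n. 1 / (real (d i) * (real (d i) - 1)))"
  have d2: "2 \<le> real (d i)" for i
    using d[of i] by simp
  have p: "0 \<le> p n" for n
    unfolding p_def using d2 by (intro prod_nonneg) (smt (verit) divide_nonneg_nonneg mult_nonneg_nonneg)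
  \<comment> \<open>Adding the cylinder length \<open>p k\<close> makes the induction work: the next
    term and the next length together are \<open>p k / (a - 1) \<le> p k\<close>.\<close>
  have partial: "(\<Sum>n<k. 1 / real (d n) * p n) + p k \<le> 1" for k
  proof (induction k)
    case (Suc k)
    define a where "a = real (d k)"
    have a: "2 \<le> a"
      using d2 by (simp add: a_def)
    have "1 / a * p k + p (Suc k) = p k * (1 / (a - 1))"
      using a by (simp add: p_def a_def[symmetric] field_simps)
    also have "\<dots> \<le> p k * 1"
      using a p by (intro mult_left_mono) auto
    finally show ?case
      using Suc by (simp add: a_def)
  qed (simp add: p_def)
  then have le: "(\<Sum>n<k. 1 / real (d n) * p n) \<le> 1" for k
    using p[of k] partial[of k] by linarith
  have nonneg: "0 \<le> 1 / real (d n) * p n" for n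
    using p by simp
  show sum: "summable (\<lambda>n. 1 / real (d n) * (\<Prod>i<n. 1 / (real (d i) * (real (d i) - 1))))"
    using summableI_nonneg_bounded[OF nonneg le] by (simp add: p_def)
  show "luroth_point d \<le> 1"
    using suminf_le_const[OF sum] le unfolding luroth_point_def p_def by blast
  show "0 \<le> luroth_point d"
    using suminf_nonneg[OF sum] nonneg unfolding luroth_point_def p_def by blast
qed

lemma luroth_point_rec:
  assumes d: "\<And>i. 2 \<le> d i"
  shows "luroth_point d = luroth_branch (d 0) (luroth_point (\<lambda>i. d (Suc i)))"
proof -
  define r where "r = (\<lambda>i. 1 / (real (d i) * (real (d i) - 1)))"
  have "luroth_point d - 1 / real (d 0) = (\<Sum>n. 1 / real (d (Suc n)) * (\<Prod>i<Suc n. r i))"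
    using suminf_split_head[OF luroth_point_series(1)[of d]] d by (simp add: luroth_point_def r_def)
  also have "\<dots> = (\<Sum>n. r 0 * (1 / real (d (Suc n)) * (\<Prod>i<n. r (Suc i))))"
    by (simp add: prod.lessThan_Suc_shift mult_ac del: prod.lessThan_Suc)
  also have "\<dots> = r 0 * luroth_point (\<lambda>i. d (Suc i))"
    unfolding luroth_point_def r_def using d by (intro suminf_mult luroth_point_series)
  finally have "luroth_point d = 1 / real (d 0) + r 0 * luroth_point (\<lambda>i. d (Suc i))"
    by simp
  then show ?thesis
    using d by (simp add: luroth_branch_altdef r_def)
qed

lemma luroth_point_unit:
  assumes "\<And>i. 2 \<le> d i"
  shows "0 < luroth_point d" "luroth_point d \<le> 1"
proof -
  have "0 \<le> luroth_point (\<lambda>i. d (Suc i))" "2 \<le> d 0"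
    by (rule luroth_point_series(2), rule assms) (rule assms)
  then have "0 < luroth_branch (d 0) (luroth_point (\<lambda>i. d (Suc i)))"
    by (simp add: luroth_branch_altdef add_pos_nonneg)
  then show "0 < luroth_point d"
    using luroth_point_rec[of d] assms by simp
  show "luroth_point d \<le> 1"
    by (rule luroth_point_series(3)) (rule assms)
qed

lemma luroth_point_bounds:
  assumes "\<And>i. 2 \<le> d i"
  shows "1 / real (d 0) < luroth_point d" "luroth_point d \<le> 1 / (real (d 0) - 1)"
  using luroth_branch_bounds[of "d 0" "luroth_point (\<lambda>i. d (Suc i))"]
    luroth_point_unit[of "\<lambda>i. d (Suc i)"] luroth_point_rec[of d] assms by simp_all

lemma luroth_funpow_point:
  assumes "\<And>i. 2 \<le> d i"
  shows "(luroth ^^ n) (luroth_point d) = luroth_point (\<lambda>i. d (n + i))"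
  using assms
proof (induction n arbitrary: d)
  case (Suc n)
  have "luroth (luroth_point d) = luroth_point (\<lambda>i. d (Suc i))"
    using luroth_branch_inverse(2)[of "d 0"] luroth_point_unit[of "\<lambda>i. d (Suc i)"]
      luroth_point_rec[of d] Suc.prems by simp
  then show ?case
    using Suc.IH[of "\<lambda>i. d (Suc i)"] Suc.prems by (simp add: funpow_Suc_right del: funpow.simps)
qed simp

text \<open>Along a common prefix both points pass through the same affine branches, so constants
  cancel and only the contraction ratios remain.\<close>

lemma luroth_point_diff:
  assumes "\<And>i. 2 \<le> d i" "\<And>i. 2 \<le> e i" "\<And>i. i < n \<Longrightarrow> d i = e i"
  shows "luroth_point d - luroth_point e =
    (\<Prod>i<n. 1 / (real (d i) * (real (d i) - 1))) *
    (luroth_point (\<lambda>i. d (n + i)) - luroth_point (\<lambda>i. e (n + i)))"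
  using assms
proof (induction n arbitrary: d e)
  case (Suc n)
  have "luroth_point d - luroth_point e = 1 / (real (d 0) * (real (d 0) - 1)) *
      (luroth_point (\<lambda>i. d (Suc i)) - luroth_point (\<lambda>i. e (Suc i)))"
    using luroth_point_rec[of d] luroth_point_rec[of e] Suc.prems(1,2) Suc.prems(3)[of 0]
    by (simp add: luroth_branch_diff)
  then show ?case
    using Suc.IH[of "\<lambda>i. d (Suc i)" "\<lambda>i. e (Suc i)"] Suc.prems
    by (simp add: prod.lessThan_Suc_shift mult_ac del: prod.lessThan_Suc)
qed simp

text \<open>A smaller first digit gives a larger point, and \<open>1 / d 0\<close> lies between the
  two: \<open>e\<close> stays at or below it, while \<open>d\<close> exceeds it by the contracted
  value of its tail, which is above \<open>1 / d 1\<close>.\<close>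

lemma luroth_point_gap:
  assumes "\<And>i. 2 \<le> d i" "\<And>i. 2 \<le> e i" "d 0 < e 0"
  shows "1 / (real (d 0) * (real (d 0) - 1)) * (1 / real (d 1)) \<le> luroth_point d - luroth_point e"
proof -
  define a where "a = real (d 0)"
  have a: "2 \<le> a" "a \<le> real (e 0) - 1"
    using assms(1)[of 0] assms(3) by (auto simp: a_def)
  have "luroth_point d = 1 / a + 1 / (a * (a - 1)) * luroth_point (\<lambda>i. d (Suc i))"
    using luroth_point_rec[of d] assms(1) by (simp add: luroth_branch_altdef a_def)
  moreover have "1 / (a * (a - 1)) * (1 / real (d 1)) \<le> 1 / (a * (a - 1)) * luroth_point (\<lambda>i. d (Suc i))"
    using luroth_point_bounds(1)[of "\<lambda>i. d (Suc i)"] assms(1) a by (intro mult_left_mono) auto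
  moreover have "luroth_point e \<le> 1 / a"
    using luroth_point_bounds(2)[of e] assms(2) a frac_le[of 1 1 a "real (e 0) - 1"] by simp
  ultimately show ?thesis
    by (simp add: a_def)
qed

section \<open>The lower bound\<close>

text \<open>Covers of the image of a map whose inverse is Hoelder continuous pull back to covers by intervals.\<close>

lemma hausdorff_measure_nonzero:
  fixes f :: "real \<Rightarrow> 'a::metric_space"
  assumes T: "0 < emeasure lborel T" and C: "0 < C" and s: "0 \<le> s"
    and holder: "\<And>t u. t \<in> T \<Longrightarrow> u \<in> T \<Longrightarrow> \<bar>t - u\<bar> \<le> C * dist (f t) (f u) powr s"
    and sub: "f ` T \<subseteq> A"
  shows "hausdorff_measure s A \<noteq> 0"
proof
  assume "hausdorff_measure s A = 0"
  moreover obtain r where r: "0 < r" "ennreal r < emeasure lborel T"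
    using ennreal_pos_real_less[OF T] by blast
  \<comment> \<open>Each set of the cover will be replaced by an interval of length
    \<open>2 * C\<close> times its cost, so this budget keeps the total length below
    \<open>r\<close>. The mesh bound 1 is an arbitrary choice.\<close>
  moreover have "0 < ennreal (r / (2 * C))" "(0::real) < 1"
    using r C by auto
  ultimately obtain U :: "nat \<Rightarrow> 'a set" where U: "A \<subseteq> (\<Union>i. U i)" "\<And>i. bounded (U i)"
    "(\<Sum>i. hausdorff_gauge s (U i)) < ennreal (r / (2 * C))"
    unfolding hausdorff_null_iff by metis
  \<comment> \<open>The preimage need not be measurable, so it is enclosed in an interval centred at
    one of its points.\<close>
  have "\<exists>J. {t \<in> T. f t \<in> U i} \<subseteq> J \<and> J \<in> sets lborel \<and>
      emeasure lborel J \<le> ennreal (2 * C) * hausdorff_gauge s (U i)" for i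
  proof (cases "{t \<in> T. f t \<in> U i} = {}")
    case False
    then obtain t where t: "t \<in> T" "f t \<in> U i"
      by blast
    define L where "L = C * diameter (U i) powr s"
    have L: "0 \<le> L"
      using C by (simp add: L_def)
    have "\<bar>t - u\<bar> \<le> L" if u: "u \<in> T" "f u \<in> U i" for u
    proof -
      have "dist (f t) (f u) powr s \<le> diameter (U i) powr s"
        using diameter_bounded_bound[OF U(2) t(2) u(2)] s by (intro powr_mono2) auto
      then have "C * dist (f t) (f u) powr s \<le> L"
        using C by (simp add: L_def)
      then show ?thesis
        using holder[OF t(1) u(1)] by linarith
    qed
    then have "{t \<in> T. f t \<in> U i} \<subseteq> {t - L..t + L}"
      by (force simp: abs_le_iff)
    moreover have "emeasure lborel {t - L..t + L} = ennreal (2 * C) * ennreal (diameter (U i) powr s)"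
      using L C by (simp add: L_def ennreal_mult'[symmetric])
    \<comment> \<open>For \<open>s = 0\<close> the gauge of a nonempty set is 1, whereas
      \<open>powr\<close> yields 0 on diameter 0; the inequality holds in both cases.\<close>
    moreover have "ennreal (diameter (U i) powr s) \<le> hausdorff_gauge s (U i)"
      using t by (auto simp: hausdorff_gauge_def powr_def)
    ultimately show ?thesis
      by (intro exI[of _ "{t - L..t + L}"]) (auto intro: mult_left_mono)
  qed (auto intro!: exI[of _ "{}"])
  then obtain J where J: "\<And>i. {t \<in> T. f t \<in> U i} \<subseteq> J i" "\<And>i. J i \<in> sets lborel"
      "\<And>i. emeasure lborel (J i) \<le> ennreal (2 * C) * hausdorff_gauge s (U i)"
    by metis
  have "T \<subseteq> (\<Union>i. J i)"
  proof
    fix t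
    assume t: "t \<in> T"
    then obtain i where "f t \<in> U i"
      using sub U(1) by blast
    then have "t \<in> J i"
      using t J(1)[of i] by auto
    then show "t \<in> (\<Union>i. J i)"
      by (rule UN_I[OF UNIV_I])
  qed
  then have "emeasure lborel T \<le> emeasure lborel (\<Union>i. J i)"
    using J(2) by (intro emeasure_mono) auto
  also have "\<dots> \<le> (\<Sum>i. emeasure lborel (J i))"
    using J(2) by (intro emeasure_subadditive_countably) auto
  also have "\<dots> \<le> (\<Sum>i. ennreal (2 * C) * hausdorff_gauge s (U i))"
    using J(3) by (intro suminf_le) auto
  also have "\<dots> \<le> ennreal (2 * C) * ennreal (r / (2 * C))"
    using U(3) by (auto intro: mult_left_mono)
  also have "\<dots> = ennreal r"
    using C r by (simp add: ennreal_mult[symmetric])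
  finally show False
    using r(2) by simp
qed

text \<open>Mixed radix digits of \<open>t \<in> [0, 1)\<close>, where the digit at position \<open>n\<close> has \<open>2 ^ (n + 1)\<close> values.
  Shifting them by \<open>2 ^ (n + 1)\<close> gives admissible Lueroth digits which tend to infinity.\<close>

primrec radix_rem :: "real \<Rightarrow> nat \<Rightarrow> real" where
  "radix_rem t 0 = t"
| "radix_rem t (Suc n) = frac (2 ^ Suc n * radix_rem t n)"

definition radix_digit :: "real \<Rightarrow> nat \<Rightarrow> nat" where
  "radix_digit t n = 2 ^ Suc n + nat \<lfloor>2 ^ Suc n * radix_rem t n\<rfloor>"

lemma radix_rem_bounds:
  assumes "t \<in> {0..<1}"
  shows "0 \<le> radix_rem t n" "radix_rem t n < 1"
  using assms by (induction n) (simp_all add: frac_lt_1 del: power_Suc)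

lemma radix_digit_ge: "2 ^ Suc n \<le> radix_digit t n"
  by (simp add: radix_digit_def)

lemma radix_digit_ge_2: "2 \<le> radix_digit t n"
proof -
  have "(2::nat) ^ 1 \<le> 2 ^ Suc n"
    by (intro power_increasing) auto
  then show ?thesis
    using radix_digit_ge[of n t] unfolding power_one_right by (rule order_trans)
qed

lemma radix_digit_less:
  assumes "t \<in> {0..<1}"
  shows "radix_digit t n < 2 ^ (n + 2)"
proof -
  have "2 ^ Suc n * radix_rem t n < 2 ^ Suc n * 1"
    using radix_rem_bounds[OF assms, of n] by (intro mult_strict_left_mono) auto
  then have "\<lfloor>2 ^ Suc n * radix_rem t n\<rfloor> < 2 ^ Suc n"
    by (simp add: floor_less_iff)
  then have "nat \<lfloor>2 ^ Suc n * radix_rem t n\<rfloor> < 2 ^ Suc n"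
    by (simp add: nat_less_iff del: power_Suc)
  then show ?thesis
    by (simp add: radix_digit_def)
qed

text \<open>Equal digits mean equal floors, which cancel; step \<open>i\<close> then stretches the
  difference by \<open>2 ^ (i + 1)\<close>, and the exponents \<open>1, ..., n\<close> sum to
  \<open>n * (n + 1) / 2\<close>.\<close>

lemma radix_rem_diff:
  assumes "t \<in> {0..<1}" "u \<in> {0..<1}" "\<And>i. i < n \<Longrightarrow> radix_digit t i = radix_digit u i"
  shows "radix_rem t n - radix_rem u n = 2 powr (real n * (real n + 1) / 2) * (t - u)"
  using assms(3)
proof (induction n)
  case (Suc n)
  have "0 \<le> \<lfloor>2 ^ Suc n * radix_rem t n\<rfloor>" "0 \<le> \<lfloor>2 ^ Suc n * radix_rem u n\<rfloor>"
    using radix_rem_bounds(1)[OF assms(1), of n] radix_rem_bounds(1)[OF assms(2), of n] by simp_all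
  then have "\<lfloor>2 ^ Suc n * radix_rem t n\<rfloor> = \<lfloor>2 ^ Suc n * radix_rem u n\<rfloor>"
    using Suc.prems[of n] by (simp add: radix_digit_def eq_nat_nat_iff)
  then have "radix_rem t (Suc n) - radix_rem u (Suc n) = 2 ^ Suc n * (radix_rem t n - radix_rem u n)"
    by (simp add: frac_def algebra_simps)
  also have "\<dots> = 2 powr real (Suc n) * (2 powr (real n * (real n + 1) / 2) * (t - u))"
    using Suc by (simp only: powr_realpow zero_less_numeral less_SucI)
  also have "\<dots> = 2 powr (real (Suc n) * (real (Suc n) + 1) / 2) * (t - u)"
    by (simp add: powr_add[symmetric] field_simps)
  finally show ?case .
qed simp

lemma radix_digits_agree_imp_close:
  assumes "t \<in> {0..<1}" "u \<in> {0..<1}" "\<And>i. i < n \<Longrightarrow> radix_digit t i = radix_digit u i"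
  shows "\<bar>t - u\<bar> \<le> 2 powr - (real n * (real n + 1) / 2)"
proof -
  have "\<bar>radix_rem t n - radix_rem u n\<bar> \<le> 1"
    using radix_rem_bounds[OF assms(1), of n] radix_rem_bounds[OF assms(2), of n] by linarith
  also have "radix_rem t n - radix_rem u n = 2 powr (real n * (real n + 1) / 2) * (t - u)"
    using assms by (rule radix_rem_diff)
  finally have "2 powr (real n * (real n + 1) / 2) * \<bar>t - u\<bar> \<le> 1"
    by (simp add: abs_mult)
  then show ?thesis
    by (simp add: powr_minus inverse_eq_divide pos_le_divide_eq mult.commute)
qed

lemma radix_digits_inj:
  assumes "t \<in> {0..<1}" "u \<in> {0..<1}" "\<And>i. radix_digit t i = radix_digit u i"
  shows "t = u"
proof -
  have "\<bar>t - u\<bar> \<le> (1 / 2) ^ n" for n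
  proof -
    have "\<bar>t - u\<bar> \<le> 2 powr - (real n * (real n + 1) / 2)"
      using assms by (intro radix_digits_agree_imp_close)
    also have "\<dots> \<le> 2 powr - real n"
    proof (intro powr_mono)
      have "real n \<le> real (n * n)"
        unfolding of_nat_le_iff by simp
      then show "- (real n * (real n + 1) / 2) \<le> - real n"
        by (simp add: algebra_simps)
    qed simp
    finally show ?thesis
      by (simp add: powr_minus powr_realpow power_one_over inverse_eq_divide)
  qed
  moreover have "(\<lambda>n. (1 / 2 :: real) ^ n) \<longlonglongrightarrow> 0"
    by (simp add: LIMSEQ_power_zero)
  ultimately have "\<bar>t - u\<bar> \<le> 0"
    by (meson LIMSEQ_le_const)
  then show ?thesis
    by simp
qed

text \<open>The digit at position \<open>i\<close> is at most \<open>2 ^ (i + 2)\<close>, so its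
  contraction ratio costs at most \<open>2 * i + 4\<close> in the exponent. Positions up to
  \<open>n\<close> cost \<open>(n + 1) * (n + 4)\<close> in total, and the digit after them, which
  enters through \<open>luroth_point_gap\<close>, another \<open>n + 3\<close>.\<close>

lemma luroth_point_radix_separated_aux:
  assumes tu: "t \<in> {0..<1}" "u \<in> {0..<1}"
    and eq: "\<And>i. i < n \<Longrightarrow> radix_digit t i = radix_digit u i"
    and less: "radix_digit t n < radix_digit u n"
  shows "2 powr - ((real n)\<^sup>2 + 6 * real n + 7)
           \<le> luroth_point (radix_digit t) - luroth_point (radix_digit u)"
proof -
  define d where "d = radix_digit t"
  define r where "r = (\<lambda>i. 1 / (real (d i) * (real (d i) - 1)))"
  have d: "2 \<le> real (d i)" "real (d i) \<le> 2 powr (real i + 2)" for i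
  proof -
    show "2 \<le> real (d i)"
      using radix_digit_ge_2[of t i] by (simp add: d_def)
    have "real (d i) \<le> real (2 ^ (i + 2))"
      using radix_digit_less[OF tu(1), of i] unfolding d_def of_nat_le_iff by simp
    also have "\<dots> = 2 powr real (i + 2)"
      by (subst powr_realpow) auto
    finally show "real (d i) \<le> 2 powr (real i + 2)"
      by (simp add: add_ac)
  qed
  have r: "2 powr - (2 * real i + 4) \<le> r i" for i
  proof -
    have "real (d i) * (real (d i) - 1) \<le> 2 powr (real i + 2) * 2 powr (real i + 2)"
      using d[of i] by (intro mult_mono) auto
    also have "\<dots> = 2 powr (2 * real i + 4)"
      by (simp add: powr_add[symmetric])
    finally have "1 / 2 powr (2 * real i + 4) \<le> r i"
      using d[of i] unfolding r_def by (intro frac_le) auto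
    then show ?thesis
      by (simp only: powr_minus inverse_eq_divide)
  qed
  have prod: "2 powr - (real m * (real m + 3)) \<le> (\<Prod>i<m. r i)" for m
  proof (induction m)
    case (Suc m)
    have "2 powr - (real (Suc m) * (real (Suc m) + 3)) =
        2 powr - (real m * (real m + 3)) * 2 powr - (2 * real m + 4)"
      by (simp add: powr_add[symmetric] algebra_simps)
    also have "\<dots> \<le> (\<Prod>i<m. r i) * r m"
      using Suc r[of m] by (intro mult_mono order_trans[OF _ Suc]) auto
    finally show ?case
      by simp
  qed simp
  have "2 powr - ((real n)\<^sup>2 + 6 * real n + 7) =
      2 powr - (real (Suc n) * (real (Suc n) + 3)) * 2 powr - (real (Suc n) + 2)"
    by (simp add: powr_add[symmetric] algebra_simps power2_eq_square)
  also have "\<dots> \<le> (\<Prod>i<Suc n. r i) * (1 / real (d (Suc n)))"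
  proof (intro mult_mono prod order_trans[OF _ prod])
    have "1 / 2 powr (real (Suc n) + 2) \<le> 1 / real (d (Suc n))"
      using d[of "Suc n"] by (intro frac_le) auto
    then show "2 powr - (real (Suc n) + 2) \<le> 1 / real (d (Suc n))"
      by (simp only: powr_minus inverse_eq_divide)
  qed auto
  also have "\<dots> = (\<Prod>i<n. r i) * (r n * (1 / real (d (Suc n))))"
    by simp
  also have "\<dots> \<le> (\<Prod>i<n. r i) *
      (luroth_point (\<lambda>i. d (n + i)) - luroth_point (\<lambda>i. radix_digit u (n + i)))"
    using luroth_point_gap[of "\<lambda>i. d (n + i)" "\<lambda>i. radix_digit u (n + i)"] less radix_digit_ge_2
    by (intro mult_left_mono order_trans[OF _ prod]) (simp_all add: r_def d_def)
  also have "\<dots> = luroth_point d - luroth_point (radix_digit u)"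
    using luroth_point_diff[of d "radix_digit u" n] eq radix_digit_ge_2 by (simp add: r_def d_def)
  finally show ?thesis
    by (simp add: d_def)
qed

lemma luroth_point_radix_separated:
  assumes "t \<in> {0..<1}" "u \<in> {0..<1}"
    and "\<And>i. i < n \<Longrightarrow> radix_digit t i = radix_digit u i"
    and "radix_digit t n \<noteq> radix_digit u n"
  shows "2 powr - ((real n)\<^sup>2 + 6 * real n + 7)
           \<le> \<bar>luroth_point (radix_digit t) - luroth_point (radix_digit u)\<bar>"
proof (cases "radix_digit t n < radix_digit u n")
  case True
  then show ?thesis
    using luroth_point_radix_separated_aux[OF assms(1-3) True] by linarith
next
  case False
  then have less: "radix_digit u n < radix_digit t n"
    using assms(4) by simp
  then show ?thesis
    using luroth_point_radix_separated_aux[OF assms(2,1) assms(3)[symmetric] less] by linarith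
qed

text \<open>Both sides decay like \<open>2 powr - (c * n\<^sup>2)\<close>, with \<open>c = 1 / 2\<close> for the parameters and
  \<open>c = 1\<close> for the points; hence any exponent below \<open>1 / 2\<close> works.\<close>

lemma luroth_point_radix_holder:
  assumes s: "0 \<le> s" "s < 1 / 2"
  shows "\<exists>C>0. \<forall>t\<in>{0..<1}. \<forall>u\<in>{0..<1}.
    \<bar>t - u\<bar> \<le> C * dist (luroth_point (radix_digit t)) (luroth_point (radix_digit u)) powr s"
proof -
  define \<kappa> where "\<kappa> = 1 / 2 - s"
  \<comment> \<open>Completing the square bounds \<open>3 * n - \<kappa> * n\<^sup>2\<close> by
    \<open>9 / (4 * \<kappa>)\<close>; the 4 absorbs the remaining constant 7/2.\<close>
  define K where "K = 9 / (4 * \<kappa>) + 4"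
  have \<kappa>: "0 < \<kappa>" "s = 1 / 2 - \<kappa>"
    using s by (auto simp: \<kappa>_def)
  have K: "s * ((real n)\<^sup>2 + 6 * real n + 7) - real n * (real n + 1) / 2 \<le> K" for n
  proof -
    have "0 \<le> (2 * \<kappa> * real n - 3)\<^sup>2 / (4 * \<kappa>)"
      using \<kappa> by simp
    also have "\<dots> = \<kappa> * (real n)\<^sup>2 - 3 * real n + 9 / (4 * \<kappa>)"
      using \<kappa>(1) by (simp add: power2_eq_square field_simps)
    finally have "3 * real n - \<kappa> * (real n)\<^sup>2 \<le> 9 / (4 * \<kappa>)"
      by simp
    moreover have "0 \<le> \<kappa> * real n"
      using \<kappa> by simp
    moreover have "s * ((real n)\<^sup>2 + 6 * real n + 7) - real n * (real n + 1) / 2 =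
        3 * real n - \<kappa> * (real n)\<^sup>2 + 7 / 2 - real n / 2 - 6 * (\<kappa> * real n) - 7 * \<kappa>"
      by (simp add: \<kappa>(2) field_simps power2_eq_square)
    moreover have "0 \<le> real n"
      by simp
    ultimately show ?thesis
      using \<kappa>(1) unfolding K_def by linarith
  qed
  have "\<bar>t - u\<bar> \<le> 2 powr K * dist (luroth_point (radix_digit t)) (luroth_point (radix_digit u)) powr s"
    if tu: "t \<in> {0..<1}" "u \<in> {0..<1}" for t u
  proof (cases "t = u")
    case False
    define n where "n = (LEAST n. radix_digit t n \<noteq> radix_digit u n)"
    have "\<exists>n. radix_digit t n \<noteq> radix_digit u n"
      using radix_digits_inj[OF tu] False by blast
    then have n: "radix_digit t n \<noteq> radix_digit u n"
      unfolding n_def by (rule LeastI_ex)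
    have eq: "radix_digit t i = radix_digit u i" if "i < n" for i
      using not_less_Least that unfolding n_def by blast
    have "\<bar>t - u\<bar> \<le> 2 powr - (real n * (real n + 1) / 2)"
      using radix_digits_agree_imp_close[OF tu eq] .
    also have "\<dots> \<le> 2 powr (K + - ((real n)\<^sup>2 + 6 * real n + 7) * s)"
      using K[of n] by (intro powr_mono) (auto simp: algebra_simps)
    also have "\<dots> = 2 powr K * (2 powr - ((real n)\<^sup>2 + 6 * real n + 7)) powr s"
      by (simp only: powr_add powr_powr)
    also have "\<dots> \<le> 2 powr K * dist (luroth_point (radix_digit t)) (luroth_point (radix_digit u)) powr s"
      using luroth_point_radix_separated[OF tu eq n] s(1)
      by (intro mult_left_mono powr_mono2) (auto simp: dist_real_def)
    finally show ?thesis .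
  qed simp
  then show ?thesis
    by (intro exI[of _ "2 powr K"]) auto
qed

text \<open>The \<open>n\<close>-th iterate has first digit at least \<open>2 ^ (n + 1)\<close>, so
  it is at most \<open>1 / (2 ^ (n + 1) - 1) \<le> 1 / 2 ^ n\<close>. Two orbits tending to 0 are
  asymptotic.\<close>

lemma luroth_point_radix_in_AS:
  assumes "(\<lambda>n. (luroth ^^ n) x) \<longlonglongrightarrow> 0" "luroth_point (radix_digit t) \<noteq> x"
  shows "luroth_point (radix_digit t) \<in> luroth_AS x"
proof -
  define y where "y = luroth_point (radix_digit t)"
  have y: "0 < y" "y \<le> 1"
    using luroth_point_unit[of "radix_digit t"] radix_digit_ge_2 by (simp_all add: y_def)
  have "(luroth ^^ n) y \<le> (1 / 2) ^ n" for n
  proof -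
    have "(luroth ^^ n) y \<le> 1 / (real (radix_digit t n) - 1)"
      using luroth_funpow_point[of "radix_digit t" n] radix_digit_ge_2
        luroth_point_bounds(2)[of "\<lambda>i. radix_digit t (n + i)"] by (simp add: y_def)
    also have "\<dots> \<le> 1 / 2 ^ n"
    proof (intro frac_le)
      have "real (2 ^ Suc n) \<le> real (radix_digit t n)"
        unfolding of_nat_le_iff by (rule radix_digit_ge)
      moreover have "(1::real) \<le> 2 ^ n"
        by simp
      ultimately show "2 ^ n \<le> real (radix_digit t n) - 1"
        unfolding power_Suc of_nat_mult of_nat_power of_nat_numeral by linarith
    qed auto
    finally show ?thesis
      by (simp add: power_one_over)
  qed
  moreover have "0 \<le> (luroth ^^ n) y" for n
    using luroth_funpow_pos(1)[OF y] by (simp add: less_imp_le)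
  moreover have "(\<lambda>n. (1 / 2 :: real) ^ n) \<longlonglongrightarrow> 0"
    by (simp add: LIMSEQ_power_zero)
  ultimately have "(\<lambda>n. (luroth ^^ n) y) \<longlonglongrightarrow> 0"
    using tendsto_sandwich[of "\<lambda>_. 0" "\<lambda>n. (luroth ^^ n) y" sequentially "\<lambda>n. (1 / 2) ^ n" 0]
    by simp
  from tendsto_diff[OF assms(1) this]
  have "(\<lambda>n. \<bar>(luroth ^^ n) x - (luroth ^^ n) y\<bar>) \<longlonglongrightarrow> 0"
    by (intro tendsto_rabs_zero) simp
  then show ?thesis
    using y assms(2) by (simp add: luroth_AS_def y_def)
qed

section \<open>The lower bound for the dimension of the asymptotic set\<close>

lemma hausdorff_measure_luroth_AS_nonzero:
  assumes "(\<lambda>n. (luroth ^^ n) x) \<longlonglongrightarrow> 0" "0 \<le> s" "s < 1 / 2"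
  shows "hausdorff_measure s (luroth_AS x) \<noteq> 0"
proof -
  define h where "h = (\<lambda>t. luroth_point (radix_digit t))"
  obtain C where C: "0 < C" "\<And>t u. t \<in> {0..<1} \<Longrightarrow> u \<in> {0..<1} \<Longrightarrow> \<bar>t - u\<bar> \<le> C * dist (h t) (h u) powr s"
    using luroth_point_radix_holder[OF assms(2,3)] unfolding h_def by blast
  \<comment> \<open>The point \<open>x\<close> is excluded from its own asymptotic set. The Hoelder
    bound makes \<open>h\<close> injective, also for \<open>s = 0\<close> because
    \<open>0 powr 0 = 0\<close>, so at most one parameter is removed.\<close>
  define N where "N = {t \<in> {0..<1}. h t = x}"
  have "t = u" if "t \<in> N" "u \<in> N" for t u
    using that C(2)[of t u] by (auto simp: N_def)
  then have "N = {} \<or> (\<exists>t. N = {t})"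
    by blast
  then have "N \<in> null_sets lborel"
    by (auto intro: finite_imp_null_set_lborel)
  then have "emeasure lborel ({0..<1} - N) = emeasure lborel {0..<1::real}"
    by (intro emeasure_Diff_null_set) auto
  then have "0 < emeasure lborel ({0..<1} - N)"
    by simp
  then show ?thesis
    using C(1) assms(2)
  proof (rule hausdorff_measure_nonzero)
    show "\<bar>t - u\<bar> \<le> C * dist (h t) (h u) powr s" if "t \<in> {0..<1} - N" "u \<in> {0..<1} - N" for t u
      using C(2) that by blast
    show "h ` ({0..<1} - N) \<subseteq> luroth_AS x"
      using luroth_point_radix_in_AS[OF assms(1)] by (auto simp: h_def N_def)
  qed
qed

lemma hausdorff_dim_luroth_AS_ge:
  assumes "(\<lambda>n. (luroth ^^ n) x) \<longlonglongrightarrow> 0"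
  shows "ennreal (1 / 2) \<le> hausdorff_dim (luroth_AS x)"
  unfolding hausdorff_dim_def
proof (rule Inf_greatest, clarify)
  fix s :: real
  assume "0 \<le> s" "hausdorff_measure s (luroth_AS x) = 0"
  then have "1 / 2 \<le> s"
    using hausdorff_measure_luroth_AS_nonzero[OF assms] by fastforce
  then show "ennreal (1 / 2) \<le> ennreal s"
    by (rule ennreal_leI)
qed

theorem theorem1:
  fixes x :: real
  assumes "x \<in> {0..1}"
  shows "(liminf (\<lambda>n. ereal ((luroth ^^ n) x)) > 0 \<longrightarrow> countable (luroth_AS x)) \<and>
         ((\<lambda>n. (luroth ^^ n) x) \<longlonglongrightarrow> 0 \<longrightarrow> hausdorff_dim (luroth_AS x) = ennreal (1 / 2)) \<and>
         (liminf (\<lambda>n. ereal ((luroth ^^ n) x)) = 0 \<and>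
          limsup (\<lambda>n. ereal ((luroth ^^ n) x)) > 0 \<longrightarrow>
            hausdorff_dim (luroth_AS x) \<le> ennreal (1 / 2))"
  using countable_luroth_AS[OF assms] hausdorff_dim_luroth_AS_le[OF assms]
    antisym[OF hausdorff_dim_luroth_AS_le[OF assms] hausdorff_dim_luroth_AS_ge[of x]] by blast

end
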